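(* Let $p$ be a prime with $p \equiv 2$ or $3 \pmod 5$, let $r$ be a positive integer, let $C$ be a nonzero linear block code of length $2r$ over $\mathbb{F}_{p^2}$ (i.e. a nonzero $\mathbb{F}_{p^2}$-subspace of $\mathbb{F}_{p^2}^{2r}$), and let $\rho$ be the dimension of $C$ as an $\mathbb{F}_p$-vector space. Suppose that for all $(\alpha_1,\alpha_2,\dots,\alpha_{2r}) \in C$ we have $\alpha_j = 0$ for each odd index $j$ (respectively, that for all $(\alpha_1,\dots,\alpha_{2r})\in C$ we have $\alpha_j=0$ for each even index $j$). Then: (i) $\phi(C)$ is a $[2\times 2r, \rho, 2]$ rank-metric code over $\mathbb{F}_p$; (ii) $\Lambda(\phi(C))$ is a $(2r+2, p^{\rho}, 4, 2)_p$ code; (iii) any two distinct codewords of $\Lambda(\phi(C))$ have trivial intersection (the zero subspace).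
   Context: Fix $\omega \in \mathbb{F}_{p^2}$ such that $\{1,\omega\}$ is an $\mathbb{F}_p$-basis of $\mathbb{F}_{p^2}$, so each element of $\mathbb{F}_{p^2}$ is uniquely $a+b\omega$ with $a,b\in\mathbb{F}_p$. The map $\phi:\mathbb{F}_{p^2}^2\to M_2(\mathbb{F}_p)$ is defined by $$\phi((a+b\omega, c+d\omega))=\begin{pmatrix} a+d & b+c\\ b+c+d & a+b+d\end{pmatrix}.$$ It is extended to $\phi:\mathbb{F}_{p^2}^{2r}\to M_{2\times 2r}(\mathbb{F}_p)$ by grouping coordinates in consecutive pairs: $\phi(\alpha_1,\dots,\alpha_{2r}) = (A_1\ A_2\ \cdots\ A_r)$, where $A_i=\phi((\alpha_{2i-1},\alpha_{2i}))$ is the $i$-th $2\times 2$ block. The rank distance on $M_{k\times\ell}(\mathbb{F}_q)$ is $d_R(A,B)=\operatorname{rank}(A-B)$. A $[k\times\ell,\rho,\delta]$ rank-metric code over $\mathbb{F}_q$ is an $\mathbb{F}_q$-linear subspace of $M_{k\times\ell}(\mathbb{F}_q)$ of dimension $\rho$ over $\mathbb{F}_q$ with minimum rank distance $\delta$ between distinct elements. For a set $\mathcal{C}\subseteq M_{k\times\ell}(\mathbb{F}_q)$, its lift is $\Lambda(\mathcal{C})=\{\langle (I_k\ A)\rangle : A\in\mathcal{C}\}$, where $\langle (I_k\ A)\rangle$ is the row space in $\mathbb{F}_q^{k+\ell}$ of the $k\times(k+\ell)$ matrix $(I_k\ A)$. The subspace distance is $d_S(U,V)=\dim U+\dim V-2\dim(U\cap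 V)$. An $(n,M,d,k)_q$ code is a set of $M$ $k$-dimensional subspaces of $\mathbb{F}_q^n$ whose minimum subspace distance between distinct members is $d$. *)

theory Defs
  imports
    "Jordan_Normal_Form.DL_Rank"
    "HOL-Computational_Algebra.Primes"
    "HOL-Library.Cardinality"
begin

text \<open>Finite fields are types of class \<open>field\<close> with prescribed cardinality: \<open>'a\<close> plays the role
  of the base field and \<open>'b\<close> of its quadratic extension, with inclusion \<open>\<iota> :: 'a \<Rightarrow> 'b\<close>.
  Vectors and matrices are those of \<open>Jordan_Normal_Form.Matrix\<close>, indexed from 0.\<close>

definition field_module :: "('b :: field, 'b) module" where
  "field_module = \<lparr>carrier = UNIV, mult = (*), one = 1, zero = 0, add = (+), smult = (*)\<rparr>"

definition restrict_scalars :: "('a \<Rightarrow> 'b) \<Rightarrow> ('b, 'v) module \<Rightarrow> ('a, 'v) module" where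
  "restrict_scalars \<iota> V =
     \<lparr>carrier = carrier V, mult = mult V, one = one V, zero = zero V, add = add V,
      smult = (\<lambda>a v. smult V (\<iota> a) v)\<rparr>"

definition is_ext_basis :: "('a :: field \<Rightarrow> 'b :: field) \<Rightarrow> 'b set \<Rightarrow> bool" where
  "is_ext_basis \<iota> B \<longleftrightarrow>
     vectorspace.basis (class_ring :: 'a ring) (restrict_scalars \<iota> field_module) B"

definition restricted_dim :: "('a :: field \<Rightarrow> 'b :: field) \<Rightarrow> nat \<Rightarrow> 'b vec set \<Rightarrow> nat" where
  "restricted_dim \<iota> n C =
     vectorspace.dim (class_ring :: 'a ring)
       (restrict_scalars \<iota> ((module_vec TYPE('b) n)\<lparr>carrier := C\<rparr>))"

definition coords :: "('a :: field \<Rightarrow> 'b :: field) \<Rightarrow> 'b \<Rightarrow> 'b \<Rightarrow> 'a \<times> 'a" where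
  "coords \<iota> \<omega> x = (THE (a, b). x = \<iota> a + \<iota> b * \<omega>)"

definition phi_block :: "('a :: field \<Rightarrow> 'b :: field) \<Rightarrow> 'b \<Rightarrow> 'b \<times> 'b \<Rightarrow> 'a mat" where
  "phi_block \<iota> \<omega> = (\<lambda>(x, y).
     let (a, b) = coords \<iota> \<omega> x; (c, d) = coords \<iota> \<omega> y
     in mat_of_rows_list 2 [[a + d,     b + c    ],
                            [b + c + d, a + b + d]])"

text \<open>Column \<open>j\<close> of the image lies in the block with (0-based) number \<open>j div 2\<close>, which is built
  from the coordinates with 0-based indices \<open>2 * (j div 2)\<close> and \<open>2 * (j div 2) + 1\<close>.\<close>

definition phi :: "('a :: field \<Rightarrow> 'b :: field) \<Rightarrow> 'b \<Rightarrow> nat \<Rightarrow> 'b vec \<Rightarrow> 'a mat" where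
  "phi \<iota> \<omega> r \<alpha> = mat 2 (2 * r) (\<lambda>(i, j).
     phi_block \<iota> \<omega> (\<alpha> $ (2 * (j div 2)), \<alpha> $ (2 * (j div 2) + 1)) $$ (i, j mod 2))"

definition has_min_distance :: "('x \<Rightarrow> 'x \<Rightarrow> nat) \<Rightarrow> 'x set \<Rightarrow> nat \<Rightarrow> bool" where
  "has_min_distance d S \<delta> \<longleftrightarrow>
     (\<exists>x\<in>S. \<exists>y\<in>S. x \<noteq> y \<and> d x y = \<delta>) \<and> (\<forall>x\<in>S. \<forall>y\<in>S. x \<noteq> y \<longrightarrow> \<delta> \<le> d x y)"

definition rank_dist :: "nat \<Rightarrow> 'a :: field mat \<Rightarrow> 'a mat \<Rightarrow> nat" where
  "rank_dist k A B = vec_space.rank k (A - B)"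

definition rank_metric_code :: "nat \<Rightarrow> nat \<Rightarrow> nat \<Rightarrow> nat \<Rightarrow> 'a :: field mat set \<Rightarrow> bool" where
  "rank_metric_code k l \<rho> \<delta> \<C> \<longleftrightarrow>
     subspace class_ring \<C> (module_mat TYPE('a) k l) \<and>
     vectorspace.dim class_ring ((module_mat TYPE('a) k l)\<lparr>carrier := \<C>\<rparr>) = \<rho> \<and>
     has_min_distance (rank_dist k) \<C> \<delta>"

definition lift_mat :: "nat \<Rightarrow> nat \<Rightarrow> 'a :: field mat \<Rightarrow> 'a vec set" where
  "lift_mat k l A =
     vec_space.row_space (k + l) (four_block_mat (1\<^sub>m k) A (0\<^sub>m 0 k) (0\<^sub>m 0 l))"

definition lift_code :: "nat \<Rightarrow> nat \<Rightarrow> 'a :: field mat set \<Rightarrow> 'a vec set set" where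
  "lift_code k l \<C> = lift_mat k l ` \<C>"

definition subspace_dim :: "nat \<Rightarrow> 'a :: field vec set \<Rightarrow> nat" where
  "subspace_dim n U = vectorspace.dim class_ring ((module_vec TYPE('a) n)\<lparr>carrier := U\<rparr>)"

text \<open>Natural-number subtraction does not truncate here when \<open>U\<close> and \<open>V\<close> are subspaces.\<close>

definition subspace_dist :: "nat \<Rightarrow> 'a :: field vec set \<Rightarrow> 'a vec set \<Rightarrow> nat" where
  "subspace_dist n U V = subspace_dim n U + subspace_dim n V - 2 * subspace_dim n (U \<inter> V)"

text \<open>An $(n,M,d,k)_q$ code, where \<open>q\<close> is the cardinality of the ground field \<open>'a\<close>.\<close>

definition subspace_code ::
    "nat \<Rightarrow> nat \<Rightarrow> nat \<Rightarrow> nat \<Rightarrow> nat \<Rightarrow> 'a :: field vec set set \<Rightarrow> bool" where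
  "subspace_code n M d k q \<C> \<longleftrightarrow>
     CARD('a) = q \<and> finite \<C> \<and> card \<C> = M \<and>
     (\<forall>U\<in>\<C>. subspace class_ring U (module_vec TYPE('a) n) \<and> subspace_dim n U = k) \<and>
     has_min_distance (subspace_dist n) \<C> d"

end

theory Submission
  imports "HOL-Number_Theory.Quadratic_Reciprocity" Defs
begin

text \<open>If one of the two arguments of a \<open>2 \<times> 2\<close> block vanishes, its determinant is, up to sign, the
  form \<open>u\<^sup>2 + u v - v\<^sup>2\<close> in the coordinates of the other one. Its discriminant 5 is not a square
  modulo \<open>p\<close> by quadratic reciprocity, so a nonzero codeword has an invertible block: all nonzero
  matrices in \<open>\<phi>(C)\<close> have rank 2, and \<open>\<phi>\<close> is injective on \<open>C\<close>. The row space of \<open>(I A)\<close> is the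
  graph of \<open>y \<mapsto> A\<^sup>T y\<close>, and the graphs of \<open>A\<^sup>T\<close> and \<open>B\<^sup>T\<close> meet in the kernel of \<open>(A - B)\<^sup>T\<close>, which
  is trivial. All dimensions are read off cardinalities, since a space of dimension \<open>d\<close> has \<open>p\<^sup>d\<close>
  elements.\<close>

subsection \<open>Dimension and cardinality\<close>

text \<open>The carrier is itself a finite generating set, so a finite basis \<open>B\<close>
  exists. Coefficient families on \<open>B\<close>, taken extensional so that each is counted once,
  correspond bijectively to vectors.\<close>

lemma (in vectorspace) card_carrier_eq_card_power_dim:
  assumes fin: "finite (carrier V)"
  shows "card (carrier V) = card (carrier K) ^ dim"
proof -
  have "gen_set (carrier V)"
    using in_own_span[of "carrier V"] span_is_subset2[of "carrier V"] by auto
  then have "fin_dim"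
    unfolding fin_dim_def using fin by blast
  then obtain B where B: "finite B" "basis B"
    using finite_basis_exists by blast
  then have "\<forall>v\<in>carrier V. \<exists>!a. a \<in> B \<rightarrow>\<^sub>E carrier K \<and> lincomb a B = v"
    using basis_criterion[of B] unfolding basis_def by blast
  moreover have "lincomb a B \<in> carrier V" if "a \<in> B \<rightarrow>\<^sub>E carrier K" for a
    using that B(2) unfolding basis_def by (intro lincomb_closed) auto
  ultimately have "bij_betw (\<lambda>a. lincomb a B) (B \<rightarrow>\<^sub>E carrier K) (carrier V)"
    unfolding bij_betw_def inj_on_def by (blast intro: image_eqI[OF sym])
  then have "card (carrier V) = card (B \<rightarrow>\<^sub>E carrier K)"
    by (simp add: bij_betw_same_card)
  also have "\<dots> = card (carrier K) ^ card B"
    by (simp add: card_funcsetE[OF B(1)])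
  finally show ?thesis using dim_basis[OF B] by simp
qed

lemma card_subspace_eq_CARD_power_dim:
  fixes V :: "('a :: field, 'v) module"
  assumes "subspace class_ring W V" and "finite W"
  shows "card W = CARD('a) ^ vectorspace.dim class_ring (V\<lparr>carrier := W\<rparr>)"
proof -
  interpret vectorspace class_ring V
    using assms(1) unfolding VectorSpace.subspace_def by blast
  show ?thesis
    using vectorspace.card_carrier_eq_card_power_dim[OF subspace_is_vs[OF assms(1)]] assms(2)
    by simp
qed

text \<open>A field contains 0 and 1, so \<open>CARD('a)\<close> exceeds 1 and a power of it
  determines the exponent. This turns counting into a computation of dimensions.\<close>

lemma subspace_dim_eqI:
  fixes U :: "'a :: {field,finite} vec set"
  assumes U: "subspace class_ring U (module_vec TYPE('a) n)" "finite U"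
    and card: "card U = CARD('a) ^ k"
  shows "subspace_dim n U = k"
proof -
  have "CARD('a) > 1"
    using card_mono[of UNIV "{0, 1 :: 'a}"] by simp
  then show ?thesis
    using card_subspace_eq_CARD_power_dim[OF U] card by (simp add: subspace_dim_def)
qed

lemma finite_carrier_vec: "finite (carrier_vec n :: 'a :: finite vec set)"
proof (rule finite_subset)
  show "(carrier_vec n :: 'a vec set) \<subseteq> vec_of_list ` {xs. set xs \<subseteq> UNIV \<and> length xs = n}"
  proof
    fix v :: "'a vec" assume "v \<in> carrier_vec n"
    then show "v \<in> vec_of_list ` {xs. set xs \<subseteq> UNIV \<and> length xs = n}"
      by (intro image_eqI[of _ _ "list_of_vec v"]) (auto simp: vec_list)
  qed
qed (intro finite_imageI finite_lists_length_eq, simp)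

lemma card_carrier_vec: "card (carrier_vec n :: 'a :: {field,finite} vec set) = CARD('a) ^ n"
proof -
  interpret vec_space "TYPE('a)" n .
  show ?thesis
    using card_carrier_eq_card_power_dim[OF finite_carrier_vec] unfolding dim_is_n .
qed

lemma subspace_dim_zero: "subspace_dim n {0\<^sub>v n :: 'a :: {field,finite} vec} = 0"
proof (rule subspace_dim_eqI)
  interpret vec_space "TYPE('a)" n .
  have "subspace class_ring (span {}) V" by (rule span_is_subspace) simp
  then show "subspace class_ring {0\<^sub>v n :: 'a vec} (module_vec TYPE('a) n)"
    by (simp add: span_empty)
qed simp_all

subsection \<open>The form \<open>x\<^sup>2 + x y - y\<^sup>2\<close>\<close>

text \<open>The squares modulo 5 are 0, 1 and 4, so p is a non-residue modulo 5. Reciprocity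
  transfers this to 5 modulo p without a sign, because (5 - 1) / 2 is even.\<close>

lemma Legendre_5_eq_minus_1:
  fixes p :: nat
  assumes "prime p" "2 < p" "p mod 5 = 2 \<or> p mod 5 = 3"
  shows "Legendre 5 (int p) = -1"
proof -
  have p5: "int p mod 5 = 2 \<or> int p mod 5 = 3"
    using assms(3) by presburger
  have "\<not> QuadRes 5 (int p)"
  proof
    assume "QuadRes 5 (int p)"
    then obtain y :: int where "y^2 mod 5 = int p mod 5"
      unfolding QuadRes_def cong_def by blast
    then have "(y mod 5)^2 mod 5 = int p mod 5" by (simp add: power_mod)
    moreover have "y mod 5 \<in> {0,1,2,3,4}" by auto
    ultimately show False using p5 by auto
  qed
  then have "Legendre (int p) 5 = -1"
    unfolding Legendre_def cong_def using p5 by auto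
  moreover have "Legendre (int p) (int 5) * Legendre (int 5) (int p)
      = (-1) ^ ((p - 1) div 2 * ((5 - 1) div 2))"
    using assms by (intro Quadratic_Reciprocity) auto
  ultimately show ?thesis by simp
qed

lemma CHAR_eq_CARD_if_prime:
  assumes "prime CARD('a :: {field,finite})"
  shows "CHAR('a) = CARD('a)"
  using assms CHAR_dvd_CARD[where 'a='a] CHAR_not_1'[where 'a='a]
  by (auto simp: prime_nat_iff)

text \<open>In characteristic p the images of 0, ..., p - 1 are distinct, so they exhaust a field of
  p elements. Equations in \<open>'a\<close> can then be read as integer congruences, the setting of
  quadratic reciprocity.\<close>

lemma surj_of_int_if_prime_CARD:
  assumes "prime CARD('a :: {field,finite})"
  shows "surj (of_int :: int \<Rightarrow> 'a)"
proof -
  have "inj_on (of_nat :: nat \<Rightarrow> 'a) {..<CARD('a)}"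
    by (intro inj_onI) (auto simp: of_nat_eq_iff_cong_CHAR CHAR_eq_CARD_if_prime[OF assms] cong_def)
  then have "card ((of_nat :: nat \<Rightarrow> 'a) ` {..<CARD('a)}) = CARD('a)"
    by (simp add: card_image)
  then have "(of_nat :: nat \<Rightarrow> 'a) ` {..<CARD('a)} = UNIV"
    by (intro card_subset_eq) auto
  moreover have "range (of_nat :: nat \<Rightarrow> 'a) \<subseteq> range of_int"
    by (metis of_int_of_nat_eq image_subsetI rangeI)
  ultimately show ?thesis by blast
qed

text \<open>A zero with y nonzero gives a root t = x / y of t^2 + t - 1. Lifting t to an integer and
  completing the square makes 5 a square modulo p. Since 5 is a square modulo 2, the case p = 2 is
  settled by parity instead.\<close>

lemma golden_form_anisotropic:
  fixes x y :: "'a :: {field,finite}"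
  assumes p: "prime CARD('a)" and p5: "CARD('a) mod 5 = 2 \<or> CARD('a) mod 5 = 3"
    and eq: "x^2 + x * y - y^2 = 0"
  shows "x = 0 \<and> y = 0"
proof (cases "y = 0")
  case True
  then show ?thesis using eq by simp
next
  case False
  define t where "t = x / y"
  have "x = t * y" using False by (simp add: t_def)
  then have "y^2 * (t^2 + t - 1) = 0" using eq by (simp add: algebra_simps power2_eq_square)
  then have t: "t^2 + t - 1 = 0" using False by simp
  obtain n :: int where n: "t = of_int n"
    using surj_of_int_if_prime_CARD[OF p] by (metis surjD)
  have "(of_int (n^2 + n - 1) :: 'a) = 0" using t n by simp
  then have dvd: "int CARD('a) dvd n^2 + n - 1"
    by (simp add: of_int_eq_0_iff_char_dvd CHAR_eq_CARD_if_prime[OF p] del: of_int_add of_int_diff)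
  have False
  proof (cases "CARD('a) = 2")
    case True
    \<comment> \<open>n^2 + n = n (n + 1) is even, so n^2 + n - 1 is odd for every integer
      n.\<close>
    then have "even (n^2 + n - 1)" using dvd by simp
    then show ?thesis by simp
  next
    case False
    then have gt: "2 < CARD('a)" using prime_ge_2_nat[OF p] by simp
    have "(2 * n + 1)^2 - 5 = 4 * (n^2 + n - 1)" by (simp add: algebra_simps power2_eq_square)
    then have "int CARD('a) dvd (2 * n + 1)^2 - 5"
      using dvd by (metis dvd_mult)
    then have "[(2 * n + 1)^2 = 5] (mod int CARD('a))"
      by (simp only: cong_iff_dvd_diff)
    then have "Legendre 5 (int CARD('a)) \<noteq> -1"
      unfolding Legendre_def QuadRes_def by auto
    then show ?thesis using Legendre_5_eq_minus_1[OF p gt p5] by simp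
  qed
  then show ?thesis ..
qed

subsection \<open>Matrices with two rows\<close>

text \<open>Columns i and j of \<open>A\<close> give two equations in the two coordinates of
  \<open>y\<close>. Eliminating either coordinate leaves the minor times the other one.\<close>

lemma minor_mult_vec_eq_0D:
  fixes A :: "'a :: field mat"
  assumes A: "A \<in> carrier_mat 2 n" and ij: "i < n" "j < n"
    and minor: "A $$ (0, i) * A $$ (1, j) - A $$ (0, j) * A $$ (1, i) \<noteq> 0"
    and y: "y \<in> carrier_vec 2" and Ay: "A\<^sup>T *\<^sub>v y = 0\<^sub>v n"
  shows "y = 0\<^sub>v 2"
proof -
  have eq: "A $$ (0, k) * y $ 0 + A $$ (1, k) * y $ 1 = 0" if "k < n" for k
  proof -
    have "(A\<^sup>T *\<^sub>v y) $ k = 0" using Ay that by simp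
    then show ?thesis
      using A y that by (simp add: scalar_prod_def numeral_2_eq_2)
  qed
  let ?m = "A $$ (0, i) * A $$ (1, j) - A $$ (0, j) * A $$ (1, i)"
  have "?m * y $ 0 = 0" "?m * y $ 1 = 0"
  proof -
    have "?m * y $ 0 = (A $$ (0, i) * y $ 0 + A $$ (1, i) * y $ 1) * A $$ (1, j)
        - (A $$ (0, j) * y $ 0 + A $$ (1, j) * y $ 1) * A $$ (1, i)"
      by (simp add: algebra_simps)
    then show "?m * y $ 0 = 0" using eq[OF ij(1)] eq[OF ij(2)] by simp
    have "?m * y $ 1 = (A $$ (0, j) * y $ 0 + A $$ (1, j) * y $ 1) * A $$ (0, i)
        - (A $$ (0, i) * y $ 0 + A $$ (1, i) * y $ 1) * A $$ (0, j)"
      by (simp add: algebra_simps)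
    then show "?m * y $ 1 = 0" using eq[OF ij(1)] eq[OF ij(2)] by simp
  qed
  then show ?thesis
    using minor y by (auto simp: less_2_cases_iff intro!: eq_vecI)
qed

text \<open>Columns i and j alone already span the plane, by Cramer's rule, so the column space is
  everything.\<close>

lemma rank_eq_2_if_minor:
  fixes A :: "'a :: field mat"
  assumes A: "A \<in> carrier_mat 2 n" and ij: "i < n" "j < n"
    and minor: "A $$ (0, i) * A $$ (1, j) - A $$ (0, j) * A $$ (1, i) \<noteq> 0"
  shows "vec_space.rank 2 A = 2"
proof -
  interpret vec_space "TYPE('a)" 2 .
  let ?m = "A $$ (0, i) * A $$ (1, j) - A $$ (0, j) * A $$ (1, i)"
  have ne: "i \<noteq> j" using minor by auto
  have "y \<in> col_space A" if y: "y \<in> carrier_vec 2" for y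
  proof -
    \<comment> \<open>Cramer's solution for the coefficients of columns i and j; \<open>x\<close>
      carries them at positions i and j and is 0 elsewhere.\<close>
    define s where "s = (A $$ (1, j) * y $ 0 - A $$ (0, j) * y $ 1) / ?m"
    define t where "t = (A $$ (0, i) * y $ 1 - A $$ (1, i) * y $ 0) / ?m"
    define x where "x = vec n (\<lambda>k. if k = i then s else if k = j then t else 0)"
    have row: "row A k \<bullet> x = A $$ (k, i) * s + A $$ (k, j) * t" if "k < 2" for k
    proof -
      have "row A k \<bullet> x = (\<Sum>l\<in>{0..<n}. A $$ (k, l) * x $ l)"
        using A that by (simp add: scalar_prod_def x_def)
      also have "\<dots> = (\<Sum>l\<in>{i, j}. A $$ (k, l) * x $ l)"
        using ij by (intro sum.mono_neutral_right) (auto simp: x_def)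
      also have "\<dots> = A $$ (k, i) * s + A $$ (k, j) * t"
        using ij ne by (simp add: x_def)
      finally show ?thesis .
    qed
    have s: "?m * s = A $$ (1, j) * y $ 0 - A $$ (0, j) * y $ 1"
      and t: "?m * t = A $$ (0, i) * y $ 1 - A $$ (1, i) * y $ 0"
      using minor by (simp_all add: s_def t_def)
    \<comment> \<open>The check is made after multiplication by the minor, so that no fractions
      remain.\<close>
    have distrib: "?m * (a * s + b * t) = a * (?m * s) + b * (?m * t)" for a b
      by (simp add: distrib_left mult.left_commute)
    have "?m * (A $$ (0, i) * s + A $$ (0, j) * t) = ?m * y $ 0"
      "?m * (A $$ (1, i) * s + A $$ (1, j) * t) = ?m * y $ 1"
      unfolding distrib s t by (simp_all add: algebra_simps)
    then have "A *\<^sub>v x = y"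
      using A y row minor by (auto simp: less_2_cases_iff intro!: eq_vecI)
    moreover have "x \<in> carrier_vec n" by (simp add: x_def)
    ultimately show ?thesis using A y by (auto simp: col_space_eq[OF A])
  qed
  then have "col_space A = carrier_vec 2"
    using A by (auto simp: col_space_eq[OF A])
  then have "rank A = dim"
    unfolding rank_def col_space_def by (simp add: module_vec_def)
  then show ?thesis by (simp add: dim_is_n)
qed

subsection \<open>Lifted codes\<close>

text \<open>The row space is the range of the transpose, and the transpose of (I A) stacks I on top
  of A^T.\<close>

lemma lift_mat_eq:
  fixes A :: "'a :: field mat"
  assumes A: "A \<in> carrier_mat k l"
  shows "lift_mat k l A = (\<lambda>y. y @\<^sub>v (A\<^sup>T *\<^sub>v y)) ` carrier_vec k"
proof -
  let ?B = "four_block_mat (1\<^sub>m k) A (0\<^sub>m 0 k) (0\<^sub>m 0 l)"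
  have B: "?B \<in> carrier_mat k (k + l)" using A by auto
  have "?B\<^sup>T *\<^sub>v y = y @\<^sub>v (A\<^sup>T *\<^sub>v y)" if y: "y \<in> carrier_vec k" for y
  proof -
    \<comment> \<open>The lower blocks of \<open>?B\<close> have no rows, so the block product rule
      applies to \<open>y\<close> followed by the empty vector.\<close>
    have "?B\<^sup>T *\<^sub>v (y @\<^sub>v vNil) = (1\<^sub>m k *\<^sub>v y + 0\<^sub>m k 0 *\<^sub>v vNil) @\<^sub>v (A\<^sup>T *\<^sub>v y + 0\<^sub>m l 0 *\<^sub>v vNil)"
      using four_block_mat_mult_vec[OF one_carrier_mat zero_carrier_mat
          transpose_carrier_mat[THEN iffD2, OF A] zero_carrier_mat y, of vNil 0]
      by (simp add: transpose_four_block_mat[OF one_carrier_mat A zero_carrier_mat zero_carrier_mat])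
    moreover have "y @\<^sub>v vNil = y" by (intro eq_vecI) auto
    moreover have "(0\<^sub>m m 0 :: 'a mat) *\<^sub>v vNil = 0\<^sub>v m" for m by (intro eq_vecI) auto
    ultimately show ?thesis using A y by simp
  qed
  then have "(\<lambda>y. y @\<^sub>v (A\<^sup>T *\<^sub>v y)) ` carrier_vec k = (\<lambda>y. ?B\<^sup>T *\<^sub>v y) ` carrier_vec k"
    by (intro image_cong) auto
  also have "\<dots> = lift_mat k l A"
    unfolding lift_mat_def vec_space.row_space_eq[OF B] using B by auto
  finally show ?thesis ..
qed

lemma subspace_lift_mat:
  fixes A :: "'a :: field mat"
  assumes A: "A \<in> carrier_mat k l"
  shows "subspace class_ring (lift_mat k l A) (module_vec TYPE('a) (k + l))"
proof -
  interpret vec_space "TYPE('a)" "k + l" .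
  have "set (rows (four_block_mat (1\<^sub>m k) A (0\<^sub>m 0 k) (0\<^sub>m 0 l))) \<subseteq> carrier_vec (k + l)"
    using A rows_carrier[of "four_block_mat (1\<^sub>m k) A (0\<^sub>m 0 k) (0\<^sub>m 0 l)"] by simp
  then show ?thesis
    unfolding lift_mat_def row_space_def by (rule span_is_subspace)
qed

text \<open>The first k coordinates recover \<open>y\<close>, so the lift has as many elements as
  \<open>carrier_vec k\<close>.\<close>

lemma subspace_dim_lift_mat:
  fixes A :: "'a :: {field,finite} mat"
  assumes A: "A \<in> carrier_mat k l"
  shows "subspace_dim (k + l) (lift_mat k l A) = k"
proof (rule subspace_dim_eqI[OF subspace_lift_mat[OF A]])
  have "inj_on (\<lambda>y. y @\<^sub>v (A\<^sup>T *\<^sub>v y)) (carrier_vec k)"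
    by (rule inj_onI) (auto dest: append_vec_eq[THEN iffD1, rotated 2])
  then show "card (lift_mat k l A) = CARD('a) ^ k"
    by (simp add: lift_mat_eq[OF A] card_image card_carrier_vec)
qed (simp add: lift_mat_eq[OF A] finite_carrier_vec)

text \<open>The first k coordinates of a common vector force the same \<open>y\<close> in both
  parametrisations, which puts \<open>y\<close> in the kernel of (A - B)^T.\<close>

lemma lift_mat_Int:
  fixes A B :: "'a :: field mat"
  assumes A: "A \<in> carrier_mat k l" and B: "B \<in> carrier_mat k l"
    and inj: "\<And>y. y \<in> carrier_vec k \<Longrightarrow> (A - B)\<^sup>T *\<^sub>v y = 0\<^sub>v l \<Longrightarrow> y = 0\<^sub>v k"
  shows "lift_mat k l A \<inter> lift_mat k l B = {0\<^sub>v (k + l)}"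
proof
  have zero: "0\<^sub>v k @\<^sub>v (M\<^sup>T *\<^sub>v 0\<^sub>v k) = 0\<^sub>v (k + l)" if "M \<in> carrier_mat k l" for M :: "'a mat"
    using that by (intro eq_vecI) (auto simp: scalar_prod_def)
  show "lift_mat k l A \<inter> lift_mat k l B \<subseteq> {0\<^sub>v (k + l)}"
  proof
    fix w assume "w \<in> lift_mat k l A \<inter> lift_mat k l B"
    then obtain y z where yz: "y \<in> carrier_vec k" "z \<in> carrier_vec k"
      and w: "w = y @\<^sub>v (A\<^sup>T *\<^sub>v y)" "w = z @\<^sub>v (B\<^sup>T *\<^sub>v z)"
      unfolding lift_mat_eq[OF A] lift_mat_eq[OF B] by blast
    have "y @\<^sub>v (A\<^sup>T *\<^sub>v y) = z @\<^sub>v (B\<^sup>T *\<^sub>v z)" using w by simp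
    then have eq: "y = z" "A\<^sup>T *\<^sub>v y = B\<^sup>T *\<^sub>v z"
      using append_vec_eq[OF yz] by blast+
    have "(A - B)\<^sup>T *\<^sub>v y = A\<^sup>T *\<^sub>v y - B\<^sup>T *\<^sub>v y"
      using A B yz by (simp add: transpose_minus minus_mult_distrib_mat_vec)
    also have "\<dots> = 0\<^sub>v l" using eq B yz by simp
    finally have "y = 0\<^sub>v k" by (rule inj[OF yz(1)])
    then show "w \<in> {0\<^sub>v (k + l)}"
      using w(1) zero[OF A] by simp
  qed
  have "0\<^sub>v (k + l) \<in> lift_mat k l M" if "M \<in> carrier_mat k l" for M :: "'a mat"
    unfolding lift_mat_eq[OF that] using zero[OF that] by (intro image_eqI[of _ _ "0\<^sub>v k"]) simp_all
  then show "{0\<^sub>v (k + l)} \<subseteq> lift_mat k l A \<inter> lift_mat k l B"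
    using A B by blast
qed

section \<open>Lifted codes in which differences of distinct matrices have trivial left
  kernel\<close>

context
  fixes \<C> :: "'a :: {field,finite} mat set" and k l :: nat
  assumes sub: "\<C> \<subseteq> carrier_mat k l" and k: "k > 0"
    and inj: "\<And>A B y. A \<in> \<C> \<Longrightarrow> B \<in> \<C> \<Longrightarrow> A \<noteq> B \<Longrightarrow> y \<in> carrier_vec k \<Longrightarrow>
      (A - B)\<^sup>T *\<^sub>v y = 0\<^sub>v l \<Longrightarrow> y = 0\<^sub>v k"
begin

lemma lift_mat_Int_eq_zero:
  assumes "A \<in> \<C>" "B \<in> \<C>" "A \<noteq> B"
  shows "lift_mat k l A \<inter> lift_mat k l B = {0\<^sub>v (k + l)}"
  using assms sub inj[OF assms] by (intro lift_mat_Int) auto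

text \<open>A lift shared by two distinct matrices would be its own intersection, hence zero,
  although it has dimension k > 0.\<close>

lemma inj_on_lift_mat: "inj_on (lift_mat k l) \<C>"
proof (rule inj_onI, rule ccontr)
  fix A B assume AB: "A \<in> \<C>" "B \<in> \<C>" "lift_mat k l A = lift_mat k l B" "A \<noteq> B"
  then have "lift_mat k l A = {0\<^sub>v (k + l)}"
    using lift_mat_Int_eq_zero[of A B] by simp
  then show False
    using subspace_dim_lift_mat[of A k l] subspace_dim_zero[where 'a = 'a] AB(1) sub k by auto
qed

lemma subspace_dist_lift_mat:
  assumes "A \<in> \<C>" "B \<in> \<C>" "A \<noteq> B"
  shows "subspace_dist (k + l) (lift_mat k l A) (lift_mat k l B) = 2 * k"
proof -
  have "A \<in> carrier_mat k l" "B \<in> carrier_mat k l"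
    using assms sub by auto
  then show ?thesis
    by (simp add: subspace_dist_def subspace_dim_lift_mat lift_mat_Int_eq_zero[OF assms]
      subspace_dim_zero)
qed

text \<open>All pairs of distinct lifts have the same distance; the pair \<open>A\<close>,
  \<open>B\<close> ensures that the minimum is attained.\<close>

lemma subspace_code_lift_code:
  assumes "finite \<C>" and "A \<in> \<C>" "B \<in> \<C>" "A \<noteq> B"
  shows "subspace_code (k + l) (card \<C>) (2 * k) k CARD('a) (lift_code k l \<C>)"
proof -
  have "subspace class_ring (lift_mat k l M) (module_vec TYPE('a) (k + l))"
    and "subspace_dim (k + l) (lift_mat k l M) = k" if "M \<in> \<C>" for M
    using that sub by (auto intro: subspace_lift_mat subspace_dim_lift_mat)
  moreover have "has_min_distance (subspace_dist (k + l)) (lift_mat k l ` \<C>) (2 * k)"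
    unfolding has_min_distance_def
  proof
    show "\<exists>U\<in>lift_mat k l ` \<C>. \<exists>V\<in>lift_mat k l ` \<C>. U \<noteq> V \<and> subspace_dist (k + l) U V = 2 * k"
      using assms subspace_dist_lift_mat[OF assms(2-)] inj_onD[OF inj_on_lift_mat, of A B] by blast
    show "\<forall>U\<in>lift_mat k l ` \<C>. \<forall>V\<in>lift_mat k l ` \<C>. U \<noteq> V \<longrightarrow> 2 * k \<le> subspace_dist (k + l) U V"
      using subspace_dist_lift_mat by fastforce
  qed
  ultimately show ?thesis
    using assms(1) unfolding subspace_code_def lift_code_def
    by (simp add: card_image[OF inj_on_lift_mat])
qed

end

subsection \<open>Coordinates in the quadratic extension\<close>

lemma vectorspace_restrict_scalars:
  assumes "field_hom \<iota>" and "vectorspace class_ring V"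
  shows "vectorspace class_ring (restrict_scalars \<iota> V)"
proof -
  interpret field_hom \<iota> by fact
  interpret vectorspace class_ring V by fact
  note smult = smult_assoc1[simplified] smult_l_distr[simplified] smult_r_distr[simplified]
    smult_one[simplified]
  show ?thesis
    unfolding restrict_scalars_def
    by (rule vs_criteria[OF class_field])
       (auto simp: hom_distribs smult M.a_ac intro!: bexI[of _ "\<ominus>\<^bsub>V\<^esub> _"] M.r_neg)
qed

lemma vectorspace_field_module: "vectorspace class_ring field_module"
  unfolding field_module_def
  by (rule vs_criteria[OF class_field])
     (auto simp: algebra_simps intro: exI[of _ "- _"])

text \<open>Only the spanning half of the basis property is used here; uniqueness of the coordinates
  follows later by counting.\<close>

lemma is_ext_basis_decomp:
  assumes hom: "field_hom (\<iota> :: 'a :: field \<Rightarrow> 'b :: field)" and basis: "is_ext_basis \<iota> {1, \<omega>}"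
  shows "\<exists>a b. x = \<iota> a + \<iota> b * \<omega>"
proof -
  interpret field_hom \<iota> by fact
  interpret E: vectorspace class_ring "restrict_scalars \<iota> field_module"
    by (intro vectorspace_restrict_scalars vectorspace_field_module hom)
  have car [simp]: "carrier (restrict_scalars \<iota> field_module) = UNIV"
    by (simp add: restrict_scalars_def field_module_def)
  have "x \<in> E.span {1, \<omega>}"
    using basis unfolding is_ext_basis_def E.basis_def by simp
  then obtain a where a: "x = E.lincomb a {1, \<omega>}"
    using E.finite_span[of "{1, \<omega>}"] by auto
  have ins: "E.lincomb a (insert v S) = \<iota> (a v) * v + E.lincomb a S"
    if "finite S" "v \<notin> S" for v S
    using E.lincomb_insert[of S a v] that by (simp add: restrict_scalars_def field_module_def)
  have emp: "E.lincomb a {} = 0"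
    using E.lincomb_empty by (simp add: restrict_scalars_def field_module_def)
  show ?thesis
  proof (cases "\<omega> = 1")
    \<comment> \<open>If \<omega> = 1, the set \<open>{1, \<omega>}\<close> is a singleton and the
      linear combination has one term; the coefficient of \<omega> is then taken to be 0.\<close>
    case True
    then have "x = \<iota> (a 1) + \<iota> 0 * \<omega>" using a ins[of "{}" 1] emp by simp
    then show ?thesis by blast
  next
    case False
    then have "x = \<iota> (a 1) + \<iota> (a \<omega>) * \<omega>"
      using a ins[of "{\<omega>}" 1] ins[of "{}" \<omega>] emp by simp
    then show ?thesis by blast
  qed
qed

locale finite_quadratic_extension =
  field_hom \<iota> for \<iota> :: "'a :: {field,finite} \<Rightarrow> 'b :: {field,finite}" +
  fixes \<omega> :: 'b
  assumes basis: "is_ext_basis \<iota> {1, \<omega>}" and card_ext: "CARD('b) = CARD('a) ^ 2"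
begin

text \<open>Pairs of base field elements map onto \<open>'b\<close>, and \<open>card_ext\<close>
  makes both sides equally large, so the map is injective. Hence the definite description in
  \<open>coords\<close> is well defined.\<close>

lemma coords_eqI:
  assumes x: "x = \<iota> a + \<iota> b * \<omega>"
  shows "coords \<iota> \<omega> x = (a, b)"
proof -
  let ?f = "\<lambda>(a, b). \<iota> a + \<iota> b * \<omega>"
  have "surj ?f"
    using is_ext_basis_decomp[OF field_hom_axioms basis] unfolding surj_def by fastforce
  moreover have "CARD('a \<times> 'a) = CARD('b)"
    by (simp add: card_ext power2_eq_square)
  ultimately have "inj ?f"
    by (intro eq_card_imp_inj_on) auto
  then have "(c, d) = (a, b)" if "x = \<iota> c + \<iota> d * \<omega>" for c d
    using x that by (auto simp: inj_def)
  then show ?thesis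
    unfolding coords_def using x by (intro the_equality) auto
qed

lemma coords_decomp:
  obtains a b where "x = \<iota> a + \<iota> b * \<omega>" "coords \<iota> \<omega> x = (a, b)"
  using is_ext_basis_decomp[OF field_hom_axioms basis, of x] coords_eqI by blast

lemma coords_zero: "coords \<iota> \<omega> 0 = (0, 0)"
  by (rule coords_eqI) simp

section \<open>Entries of the blocks and linearity of \<open>phi\<close> over the base field\<close>

lemma phi_block_eq:
  assumes "coords \<iota> \<omega> x = (a, b)" "coords \<iota> \<omega> y = (c, d)"
  shows "phi_block \<iota> \<omega> (x, y) $$ (0, 0) = a + d" "phi_block \<iota> \<omega> (x, y) $$ (0, Suc 0) = b + c"
    "phi_block \<iota> \<omega> (x, y) $$ (Suc 0, 0) = b + c + d"
    "phi_block \<iota> \<omega> (x, y) $$ (Suc 0, Suc 0) = a + b + d"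
  using assms by (simp_all add: phi_block_def mat_of_rows_list_def)

lemma phi_block_add:
  assumes "i < 2" "j < 2"
  shows "phi_block \<iota> \<omega> (x + x', y + y') $$ (i, j) =
    phi_block \<iota> \<omega> (x, y) $$ (i, j) + phi_block \<iota> \<omega> (x', y') $$ (i, j)"
proof -
  obtain a b where x: "x = \<iota> a + \<iota> b * \<omega>" "coords \<iota> \<omega> x = (a, b)" by (rule coords_decomp)
  obtain a' b' where x': "x' = \<iota> a' + \<iota> b' * \<omega>" "coords \<iota> \<omega> x' = (a', b')" by (rule coords_decomp)
  obtain c d where y: "y = \<iota> c + \<iota> d * \<omega>" "coords \<iota> \<omega> y = (c, d)" by (rule coords_decomp)
  obtain c' d' where y': "y' = \<iota> c' + \<iota> d' * \<omega>" "coords \<iota> \<omega> y' = (c', d')" by (rule coords_decomp)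
  have "coords \<iota> \<omega> (x + x') = (a + a', b + b')" "coords \<iota> \<omega> (y + y') = (c + c', d + d')"
    using x y x' y' by (auto intro!: coords_eqI simp: hom_add algebra_simps)
  then show ?thesis
    using assms by (auto simp: less_2_cases_iff phi_block_eq[OF x(2) y(2)] phi_block_eq[OF x'(2) y'(2)] phi_block_eq)
qed

lemma phi_block_smult:
  assumes "i < 2" "j < 2"
  shows "phi_block \<iota> \<omega> (\<iota> s * x, \<iota> s * y) $$ (i, j) = s * phi_block \<iota> \<omega> (x, y) $$ (i, j)"
proof -
  obtain a b where x: "x = \<iota> a + \<iota> b * \<omega>" "coords \<iota> \<omega> x = (a, b)" by (rule coords_decomp)
  obtain c d where y: "y = \<iota> c + \<iota> d * \<omega>" "coords \<iota> \<omega> y = (c, d)" by (rule coords_decomp)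
  have "coords \<iota> \<omega> (\<iota> s * x) = (s * a, s * b)" "coords \<iota> \<omega> (\<iota> s * y) = (s * c, s * d)"
    using x y by (auto intro!: coords_eqI simp: hom_mult algebra_simps)
  then show ?thesis
    using assms by (auto simp: less_2_cases_iff phi_block_eq[OF x(2) y(2)] phi_block_eq algebra_simps)
qed

lemma phi_carrier: "phi \<iota> \<omega> r \<alpha> \<in> carrier_mat 2 (2 * r)"
  by (simp add: phi_def)

lemma phi_add:
  assumes "\<alpha> \<in> carrier_vec (2 * r)" "\<beta> \<in> carrier_vec (2 * r)"
  shows "phi \<iota> \<omega> r (\<alpha> + \<beta>) = phi \<iota> \<omega> r \<alpha> + phi \<iota> \<omega> r \<beta>"
proof (rule eq_matI)
  fix i j assume ij: "i < dim_row (phi \<iota> \<omega> r \<alpha> + phi \<iota> \<omega> r \<beta>)" "j < dim_col (phi \<iota> \<omega> r \<alpha> + phi \<iota> \<omega> r \<beta>)"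
  \<comment> \<open>Since \<open>2 * r\<close> is even, both coordinates that feed the block of
    column j are in range.\<close>
  then have "Suc (2 * (j div 2)) < 2 * r" by (simp add: phi_def, presburger)
  then show "phi \<iota> \<omega> r (\<alpha> + \<beta>) $$ (i, j) = (phi \<iota> \<omega> r \<alpha> + phi \<iota> \<omega> r \<beta>) $$ (i, j)"
    using ij assms by (simp add: phi_def phi_block_add)
qed (simp_all add: phi_def)

lemma phi_smult:
  assumes "\<alpha> \<in> carrier_vec (2 * r)"
  shows "phi \<iota> \<omega> r (\<iota> s \<cdot>\<^sub>v \<alpha>) = s \<cdot>\<^sub>m phi \<iota> \<omega> r \<alpha>"
proof (rule eq_matI)
  fix i j assume ij: "i < dim_row (s \<cdot>\<^sub>m phi \<iota> \<omega> r \<alpha>)" "j < dim_col (s \<cdot>\<^sub>m phi \<iota> \<omega> r \<alpha>)"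
  then have "Suc (2 * (j div 2)) < 2 * r" by (simp add: phi_def, presburger)
  then show "phi \<iota> \<omega> r (\<iota> s \<cdot>\<^sub>v \<alpha>) $$ (i, j) = (s \<cdot>\<^sub>m phi \<iota> \<omega> r \<alpha>) $$ (i, j)"
    using ij assms by (simp add: phi_def phi_block_smult)
qed (simp_all add: phi_def)

lemma phi_minus:
  assumes "\<alpha> \<in> carrier_vec (2 * r)" "\<beta> \<in> carrier_vec (2 * r)"
  shows "phi \<iota> \<omega> r (\<alpha> - \<beta>) = phi \<iota> \<omega> r \<alpha> - phi \<iota> \<omega> r \<beta>"
proof -
  have "phi \<iota> \<omega> r ((\<alpha> - \<beta>) + \<beta>) = phi \<iota> \<omega> r (\<alpha> - \<beta>) + phi \<iota> \<omega> r \<beta>"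
    using assms by (intro phi_add) auto
  moreover have "(\<alpha> - \<beta>) + \<beta> = \<alpha>" using assms by (intro eq_vecI) auto
  ultimately show ?thesis
    by (intro eq_matI) (auto simp: phi_def)
qed

lemma phi_minor_ne_0:
  assumes p: "prime CARD('a)" "CARD('a) mod 5 = 2 \<or> CARD('a) mod 5 = 3"
    and \<alpha>: "\<alpha> \<in> carrier_vec (2 * r)" "\<alpha> \<noteq> 0\<^sub>v (2 * r)"
    and vanish: "(\<forall>k<r. \<alpha> $ (2 * k) = 0) \<or> (\<forall>k<r. \<alpha> $ (2 * k + 1) = 0)"
  obtains i j where "i < 2 * r" "j < 2 * r"
    "phi \<iota> \<omega> r \<alpha> $$ (0, i) * phi \<iota> \<omega> r \<alpha> $$ (1, j) -
     phi \<iota> \<omega> r \<alpha> $$ (0, j) * phi \<iota> \<omega> r \<alpha> $$ (1, i) \<noteq> 0"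
proof -
  obtain j where j: "j < 2 * r" "\<alpha> $ j \<noteq> 0"
    using \<alpha> by (metis carrier_vecD eq_vecI index_zero_vec)
  \<comment> \<open>Block k is the one built from the nonzero coordinate j and its partner.\<close>
  define k where "k = j div 2"
  have k: "k < r" and "j = 2 * k \<or> j = 2 * k + 1"
    using j(1) unfolding k_def by auto
  then have ne: "\<alpha> $ (2 * k) \<noteq> 0 \<or> \<alpha> $ (2 * k + 1) \<noteq> 0" using j(2) by auto
  let ?x = "\<alpha> $ (2 * k)" and ?y = "\<alpha> $ (2 * k + 1)"
  obtain a b where x: "?x = \<iota> a + \<iota> b * \<omega>" "coords \<iota> \<omega> ?x = (a, b)" by (rule coords_decomp)
  obtain c d where y: "?y = \<iota> c + \<iota> d * \<omega>" "coords \<iota> \<omega> ?y = (c, d)" by (rule coords_decomp)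
  have entry: "phi \<iota> \<omega> r \<alpha> $$ (0, 2 * k) = a + d" "phi \<iota> \<omega> r \<alpha> $$ (0, 2 * k + 1) = b + c"
    "phi \<iota> \<omega> r \<alpha> $$ (1, 2 * k) = b + c + d" "phi \<iota> \<omega> r \<alpha> $$ (1, 2 * k + 1) = a + b + d"
    using k phi_block_eq[OF x(2) y(2)] by (simp_all add: phi_def)
  \<comment> \<open>For a = b = 0 this determinant is d^2 - c (c + d), the negated form in c and d;
    for c = d = 0 it is a (a + b) - b^2, the form in a and b.\<close>
  have "(a + d) * (a + b + d) - (b + c) * (b + c + d) \<noteq> 0"
  proof
    assume det: "(a + d) * (a + b + d) - (b + c) * (b + c + d) = 0"
    from vanish k consider "?x = 0" | "?y = 0" by blast
    then show False
    proof cases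
      case 1
      then have "a = 0" "b = 0" using x(2) coords_zero by auto
      then have "c^2 + c * d - d^2 = 0" using det by (simp add: algebra_simps power2_eq_square)
      then have "c = 0 \<and> d = 0" by (rule golden_form_anisotropic[OF p])
      then show False using 1 ne y(1) by simp
    next
      case 2
      then have "c = 0" "d = 0" using y(2) coords_zero by auto
      then have "a^2 + a * b - b^2 = 0" using det by (simp add: algebra_simps power2_eq_square)
      then have "a = 0 \<and> b = 0" by (rule golden_form_anisotropic[OF p])
      then show False using 2 ne x(1) by simp
    qed
  qed
  then show thesis
    using that[of "2 * k" "2 * k + 1"] k entry by simp
qed

section \<open>Codes over the extension as spaces over the base field\<close>

text \<open>Closure of \<open>C\<close> under all scalars includes those of the form
  \<open>\<iota> a\<close>, so \<open>C\<close> is also a subspace over \<open>'a\<close> and can be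
  counted there.\<close>

lemma card_eq_CARD_power_restricted_dim:
  assumes C: "subspace class_ring C (module_vec TYPE('b) n)"
  shows "card C = CARD('a) ^ restricted_dim \<iota> n C"
proof -
  let ?V = "restrict_scalars \<iota> (module_vec TYPE('b) n)"
  have vs: "vectorspace class_ring (module_vec TYPE('b) n)"
    and sm: "submodule class_ring C (module_vec TYPE('b) n)"
    using C unfolding VectorSpace.subspace_def by auto
  have vs': "vectorspace class_ring ?V"
    by (rule vectorspace_restrict_scalars[OF field_hom_axioms vs])
  have "submodule class_ring C ?V"
    using sm vs' unfolding submodule_def vectorspace_def by (simp add: restrict_scalars_def)
  then have "subspace class_ring C ?V"
    using vs' unfolding VectorSpace.subspace_def by blast
  moreover have "finite C"
    using sm finite_carrier_vec by (auto simp: submodule_def module_vec_simps intro: finite_subset)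
  \<comment> \<open>\<open>restricted_dim\<close> shrinks the carrier before restricting scalars;
    the two operations commute.\<close>
  moreover have "restrict_scalars \<iota> ((module_vec TYPE('b) n)\<lparr>carrier := C\<rparr>) = ?V\<lparr>carrier := C\<rparr>"
    by (simp add: restrict_scalars_def)
  ultimately show ?thesis
    using card_subspace_eq_CARD_power_dim[of C ?V] by (simp add: restricted_dim_def)
qed

lemma subspace_phi_image:
  assumes C: "subspace class_ring C (module_vec TYPE('b) (2 * r))"
  shows "subspace class_ring (phi \<iota> \<omega> r ` C) (module_mat TYPE('a) 2 (2 * r))"
proof -
  have sm: "submodule class_ring C (module_vec TYPE('b) (2 * r))"
    using C unfolding VectorSpace.subspace_def by auto
  then have sub: "C \<subseteq> carrier_vec (2 * r)" and zero: "0\<^sub>v (2 * r) \<in> C"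
    and add: "\<And>\<alpha> \<beta>. \<alpha> \<in> C \<Longrightarrow> \<beta> \<in> C \<Longrightarrow> \<alpha> + \<beta> \<in> C"
    and smult: "\<And>s \<alpha>. \<alpha> \<in> C \<Longrightarrow> s \<cdot>\<^sub>v \<alpha> \<in> C"
    by (auto simp: submodule_def module_vec_simps)
  have phi_zero: "phi \<iota> \<omega> r (0\<^sub>v (2 * r)) = 0\<^sub>m 2 (2 * r)"
    using phi_minus[of "0\<^sub>v (2 * r)" r "0\<^sub>v (2 * r)"] phi_carrier[of r "0\<^sub>v (2 * r)"] by simp
  have "submodule class_ring (phi \<iota> \<omega> r ` C) (module_mat TYPE('a) 2 (2 * r))"
  proof (rule submodule.intro)
    show "module class_ring (module_mat TYPE('a) 2 (2 * r))"
      using matrix_vs unfolding vectorspace_def by blast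
    show "phi \<iota> \<omega> r ` C \<subseteq> carrier (module_mat TYPE('a) 2 (2 * r))"
      using phi_carrier by (auto simp: module_mat_simps)
    show "\<zero>\<^bsub>module_mat TYPE('a) 2 (2 * r)\<^esub> \<in> phi \<iota> \<omega> r ` C"
      using zero phi_zero by (metis image_eqI module_mat_simps(4))
  next
    fix A B assume "A \<in> phi \<iota> \<omega> r ` C" "B \<in> phi \<iota> \<omega> r ` C"
    then obtain \<alpha> \<beta> where "\<alpha> \<in> C" "\<beta> \<in> C" and AB: "A = phi \<iota> \<omega> r \<alpha>" "B = phi \<iota> \<omega> r \<beta>" by blast
    then have "A + B = phi \<iota> \<omega> r (\<alpha> + \<beta>)" "\<alpha> + \<beta> \<in> C"
      using add phi_add[OF subsetD[OF sub] subsetD[OF sub]] by simp_all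
    then show "A \<oplus>\<^bsub>module_mat TYPE('a) 2 (2 * r)\<^esub> B \<in> phi \<iota> \<omega> r ` C"
      by (simp add: module_mat_simps)
  next
    fix s A assume "A \<in> phi \<iota> \<omega> r ` C"
    then obtain \<alpha> where "\<alpha> \<in> C" and A: "A = phi \<iota> \<omega> r \<alpha>" by blast
    then have "s \<cdot>\<^sub>m A = phi \<iota> \<omega> r (\<iota> s \<cdot>\<^sub>v \<alpha>)" "\<iota> s \<cdot>\<^sub>v \<alpha> \<in> C"
      using smult phi_smult[OF subsetD[OF sub]] by simp_all
    then show "s \<odot>\<^bsub>module_mat TYPE('a) 2 (2 * r)\<^esub> A \<in> phi \<iota> \<omega> r ` C"
      by (simp add: module_mat_simps)
  qed
  then show ?thesis
    unfolding VectorSpace.subspace_def using matrix_vs by blast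
qed

end

section \<open>Parameters and distances of the matrix code and of its lift\<close>

theorem mainTheorem1:
  fixes p r \<rho> :: nat
    and \<iota> :: "'a :: {field, finite} \<Rightarrow> 'b :: {field, finite}"
    and \<omega> :: 'b
    and C :: "'b vec set"
  assumes "prime p"
    and "p mod 5 = 2 \<or> p mod 5 = 3"
    and "CARD('a) = p"
    and "CARD('b) = p ^ 2"
    and "field_hom \<iota>"
    and "is_ext_basis \<iota> {1, \<omega>}"
    and "r \<ge> 1"
    and "subspace class_ring C (module_vec TYPE('b) (2 * r))"
    and "C \<noteq> {0\<^sub>v (2 * r)}"
    and "\<rho> = restricted_dim \<iota> (2 * r) C"
    and "(\<forall>\<alpha>\<in>C. \<forall>j\<in>{1..2 * r}. odd j \<longrightarrow> \<alpha> $ (j - 1) = 0) \<or>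
         (\<forall>\<alpha>\<in>C. \<forall>j\<in>{1..2 * r}. even j \<longrightarrow> \<alpha> $ (j - 1) = 0)"
  shows "rank_metric_code 2 (2 * r) \<rho> 2 (phi \<iota> \<omega> r ` C)
    \<and> subspace_code (2 * r + 2) (p ^ \<rho>) 4 2 p (lift_code 2 (2 * r) (phi \<iota> \<omega> r ` C))
    \<and> (\<forall>U \<in> lift_code 2 (2 * r) (phi \<iota> \<omega> r ` C). \<forall>V \<in> lift_code 2 (2 * r) (phi \<iota> \<omega> r ` C).
          U \<noteq> V \<longrightarrow> U \<inter> V = {0\<^sub>v (2 * r + 2)})"
proof -
  interpret finite_quadratic_extension \<iota> \<omega>
    using assms(3-6) by (simp add: finite_quadratic_extension_def finite_quadratic_extension_axioms_def)
  have p: "prime CARD('a)" "CARD('a) mod 5 = 2 \<or> CARD('a) mod 5 = 3"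
    using assms(1-3) by simp_all
  let ?\<phi> = "phi \<iota> \<omega> r" and ?n = "2 * r"
  have "submodule class_ring C (module_vec TYPE('b) ?n)"
    using assms(8) unfolding VectorSpace.subspace_def by auto
  then have sub: "C \<subseteq> carrier_vec ?n" and zero: "0\<^sub>v ?n \<in> C"
    and add: "\<And>\<alpha> \<beta>. \<alpha> \<in> C \<Longrightarrow> \<beta> \<in> C \<Longrightarrow> \<alpha> + \<beta> \<in> C" and smult: "\<And>s \<alpha>. \<alpha> \<in> C \<Longrightarrow> s \<cdot>\<^sub>v \<alpha> \<in> C"
    by (auto simp: submodule_def module_vec_simps)
  have minus: "\<alpha> - \<beta> \<in> C" if "\<alpha> \<in> C" "\<beta> \<in> C" for \<alpha> \<beta>
  proof -
    have "\<alpha> - \<beta> = \<alpha> + (-1) \<cdot>\<^sub>v \<beta>" using that sub by (intro eq_vecI) auto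
    then show ?thesis using add smult that by simp
  qed
  \<comment> \<open>Passage from 1-based to 0-based indices: odd j = 2k + 1 is position 2k, even j =
    2k + 2 is position 2k + 1.\<close>
  have vanish: "(\<forall>k<r. \<alpha> $ (2 * k) = 0) \<or> (\<forall>k<r. \<alpha> $ (2 * k + 1) = 0)" if \<alpha>: "\<alpha> \<in> C" for \<alpha>
    using assms(11)
  proof
    assume "\<forall>\<alpha>\<in>C. \<forall>j\<in>{1..2 * r}. odd j \<longrightarrow> \<alpha> $ (j - 1) = 0"
    then have "\<forall>j\<in>{1..2 * r}. odd j \<longrightarrow> \<alpha> $ (j - 1) = 0" using \<alpha> by blast
    then have "odd (2 * k + 1) \<longrightarrow> \<alpha> $ (2 * k + 1 - 1) = 0" if "k < r" for k
      by (rule bspec) (use that in simp)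
    then show ?thesis by simp
  next
    assume "\<forall>\<alpha>\<in>C. \<forall>j\<in>{1..2 * r}. even j \<longrightarrow> \<alpha> $ (j - 1) = 0"
    then have "\<forall>j\<in>{1..2 * r}. even j \<longrightarrow> \<alpha> $ (j - 1) = 0" using \<alpha> by blast
    then have "even (2 * k + 2) \<longrightarrow> \<alpha> $ (2 * k + 2 - 1) = 0" if "k < r" for k
      by (rule bspec) (use that in simp)
    then show ?thesis by simp
  qed
  \<comment> \<open>By linearity the difference is the image of the nonzero codeword \<alpha> -
    \<beta>. This one fact yields injectivity, rank 2 and the trivial left kernel below.\<close>
  have minor: "\<exists>i<?n. \<exists>j<?n. (?\<phi> \<alpha> - ?\<phi> \<beta>) $$ (0, i) * (?\<phi> \<alpha> - ?\<phi> \<beta>) $$ (1, j) -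
      (?\<phi> \<alpha> - ?\<phi> \<beta>) $$ (0, j) * (?\<phi> \<alpha> - ?\<phi> \<beta>) $$ (1, i) \<noteq> 0"
    if ab: "\<alpha> \<in> C" "\<beta> \<in> C" "\<alpha> \<noteq> \<beta>" for \<alpha> \<beta>
  proof -
    have car: "\<alpha> \<in> carrier_vec ?n" "\<beta> \<in> carrier_vec ?n" using ab sub by auto
    have "\<alpha> = (\<alpha> - \<beta>) + \<beta>" using car by (intro eq_vecI) auto
    then have "\<alpha> - \<beta> \<noteq> 0\<^sub>v ?n" using ab(3) car by auto
    then show ?thesis
      using phi_minor_ne_0[OF p, of "\<alpha> - \<beta>" r] car vanish[OF minus[OF ab(1,2)]]
      unfolding phi_minus[OF car] by (metis minus_carrier_vec)
  qed
  have diff_carrier: "?\<phi> \<alpha> - ?\<phi> \<beta> \<in> carrier_mat 2 ?n" for \<alpha> \<beta>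
    using phi_carrier by (intro minus_carrier_mat)
  have inj: "inj_on ?\<phi> C"
  proof (rule inj_onI, rule ccontr)
    fix \<alpha> \<beta> assume "\<alpha> \<in> C" "\<beta> \<in> C" "?\<phi> \<alpha> = ?\<phi> \<beta>" "\<alpha> \<noteq> \<beta>"
    then show False using minor[of \<alpha> \<beta>] phi_carrier[of r \<beta>] by auto
  qed
  have fin: "finite C" using sub finite_carrier_vec by (rule finite_subset)
  have card: "card (?\<phi> ` C) = p ^ \<rho>"
    using card_eq_CARD_power_restricted_dim[OF assms(8)] assms(3,10) by (simp add: card_image[OF inj])
  \<comment> \<open>The images of \<gamma> and 0 are the pair that attains both minimum
    distances.\<close>
  obtain \<gamma> where \<gamma>: "\<gamma> \<in> C" "\<gamma> \<noteq> 0\<^sub>v ?n" using zero assms(9) by blast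
  then have ne: "?\<phi> \<gamma> \<noteq> ?\<phi> (0\<^sub>v ?n)" using inj_onD[OF inj] zero by blast
  have rank: "rank_dist 2 A B = 2" if "A \<in> ?\<phi> ` C" "B \<in> ?\<phi> ` C" "A \<noteq> B" for A B
    using that minor rank_eq_2_if_minor[OF diff_carrier] unfolding rank_dist_def by blast
  have inj_mult: "y = 0\<^sub>v 2"
    if "A \<in> ?\<phi> ` C" "B \<in> ?\<phi> ` C" "A \<noteq> B" "y \<in> carrier_vec 2" "(A - B)\<^sup>T *\<^sub>v y = 0\<^sub>v ?n" for A B y
    using that minor minor_mult_vec_eq_0D[OF diff_carrier] by blast
  have sub_mat: "?\<phi> ` C \<subseteq> carrier_mat 2 ?n" using phi_carrier by blast
  have "rank_metric_code 2 ?n \<rho> 2 (?\<phi> ` C)"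
    unfolding rank_metric_code_def
  proof (intro conjI)
    show "subspace class_ring (?\<phi> ` C) (module_mat TYPE('a) 2 ?n)"
      by (rule subspace_phi_image[OF assms(8)])
    \<comment> \<open>The image has as many elements as \<open>C\<close>; counting both over the
      base field equates the two dimensions as exponents of p.\<close>
    then have "p ^ \<rho> = p ^ vectorspace.dim class_ring ((module_mat TYPE('a) 2 ?n)\<lparr>carrier := ?\<phi> ` C\<rparr>)"
      using card_subspace_eq_CARD_power_dim card fin assms(3) by (metis finite_imageI)
    then show "vectorspace.dim class_ring ((module_mat TYPE('a) 2 ?n)\<lparr>carrier := ?\<phi> ` C\<rparr>) = \<rho>"
      using prime_gt_1_nat[OF assms(1)] by simp
    show "has_min_distance (rank_dist 2) (?\<phi> ` C) 2"
      unfolding has_min_distance_def using rank \<gamma>(1) zero ne by (metis imageI order_refl)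
  qed
  moreover have "subspace_code (?n + 2) (p ^ \<rho>) 4 2 p (lift_code 2 ?n (?\<phi> ` C))"
    using subspace_code_lift_code[OF sub_mat _ inj_mult _ imageI[OF \<gamma>(1)] imageI[OF zero] ne]
      fin card assms(3) by (simp add: add.commute)
  moreover have "\<forall>U \<in> lift_code 2 ?n (?\<phi> ` C). \<forall>V \<in> lift_code 2 ?n (?\<phi> ` C).
      U \<noteq> V \<longrightarrow> U \<inter> V = {0\<^sub>v (?n + 2)}"
  proof (intro ballI impI)
    fix U V assume U: "U \<in> lift_code 2 ?n (?\<phi> ` C)" and V: "V \<in> lift_code 2 ?n (?\<phi> ` C)"
      and ne: "U \<noteq> V"
    obtain A where A: "A \<in> ?\<phi> ` C" "U = lift_mat 2 ?n A"
      using U unfolding lift_code_def by (rule imageE)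
    obtain B where B: "B \<in> ?\<phi> ` C" "V = lift_mat 2 ?n B"
      using V unfolding lift_code_def by (rule imageE)
    have "A \<noteq> B" using ne unfolding A(2) B(2) by (rule contrapos_nn) simp
    then have "lift_mat 2 ?n A \<inter> lift_mat 2 ?n B = {0\<^sub>v (2 + ?n)}"
      by (intro lift_mat_Int_eq_zero[OF sub_mat _ inj_mult] A(1) B(1)) simp_all
    then show "U \<inter> V = {0\<^sub>v (?n + 2)}"
      unfolding A(2) B(2) by (simp only: add.commute)
  qed
  ultimately show ?thesis by blast
qed

end
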